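(* Let $f\in B\mathcal S_{\mathbf M}$ have a Fourier series of the form $(F)$ (see context). Then for every $n\in\mathbb N$ and every $\alpha>0$, $$\omega_\alpha\Big(f,\frac{\pi}{\lambda_n}\Big)_{\mathbf M}\le\Big(\frac{\pi}{\lambda_n}\Big)^\alpha\sum_{\nu=1}^n(\lambda_\nu^\alpha-\lambda_{\nu-1}^\alpha)E_{\lambda_\nu}(f)_{\mathbf M}.$$
   Context: Almost periodic functions. A locally Lebesgue integrable $f:\mathbb R\to\mathbb C$ is called $B$-a.p. (Besicovitch almost periodic of order 1) if there are trigonometric sums $\tau_N(x)=\sum_{k} a_k e^{i\mu_k x}$ (finite sums, $\mu_k\in\mathbb R$, $a_k\in\mathbb C$) with $\limsup_{T\to\infty}\frac1{2T}\int_{-T}^T|f-\tau_N|\,dx\to0$ as $N\to\infty$. For such $f$ the mean value $A\{f\}=\lim_{T\to\infty}\frac1T\int_0^Tf(x)\,dx$ exists, and the Fourier exponents of $f$ are the (at most countably many) $\lambda\in\mathbb R$ with $A\{f(\cdot)e^{-i\lambda\cdot}\}\ne0$. Exponents. $\{\lambda_k\}_{k\in\mathbb Z}$ is a real sequence with $\lambda_0=0$, $\lambda_{-k}=-\lambda_k$, $0<\lambda_k<\lambda_{k+1}$ for $k\ge1$, and $\lambda_k\to\infty$ as $k\to\infty$. All functions considered are $B$-a.p. with all Fourier exponents in $\{\lambda_k\}_{k\in\mathbb Z}$; put $A_k(f)=A\{f(\cdot)e^{-i\lambda_k\cdot}\}$. We say $f$ has a Fourier series of the form $(F)$ if its Fourier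 series is $\sum_{k\in\mathbb Z}A_k(f)e^{i\lambda_kx}$ with $|A_k(f)|+|A_{-k}(f)|>0$ for all $k\ge 1$. The space. $\mathbf M=\{M_k\}_{k\in\mathbb Z}$ is a sequence of Orlicz functions: each $M_k:[0,\infty)\to[0,\infty)$ is nondecreasing and convex, $M_k(0)=0$, $M_k(t)\to\infty$ as $t\to\infty$. Let $M_k^*(v)=\sup\{uv-M_k(u):u\ge0\}$, and let $\Gamma$ be the set of sequences of positive numbers $\gamma=\{\gamma_k\}_{k\in\mathbb Z}$ with $\sum_{k\in\mathbb Z}M_k^*(\gamma_k)\le1$. The space $B\mathcal S_{\mathbf M}$ consists of those functions $f$ for which $\|f\|_{\mathbf M}:=\sup\{\sum_{k\in\mathbb Z}\gamma_k|A_k(f)|:\gamma\in\Gamma\}<\infty$; functions with the same Fourier series are identified. Best approximation. $E_{\lambda_n}(f)_{\mathbf M}=\inf\|f-g\|_{\mathbf M}$, the infimum over all $g$ whose Fourier exponents lie in the interval $(-\lambda_n,\lambda_n)$. Modulus of smoothness of order $\alpha>0$. With $\varphi_\alpha(t)=2^{\alpha/2}(1-\cos t)^{\alpha/2}=2^\alpha|\sin(t/2)|^\alpha$, for $\delta\ge0$, $$\omega_\alpha(f,\delta)_{\mathbf M}=\sup_{|h|\le\delta}\ \sup\Big\{\sum_{k\in\mathbb Z}\gamma_k\varphi_\alpha(\lambda_kh)|A_k(f)|:\gamma\in\Gamma\Big\}.$$ *)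

theory Defs
  imports "HOL-Analysis.Analysis"
begin

definition trig_sum :: "(real \<Rightarrow> complex) \<Rightarrow> bool" where
  "trig_sum \<tau> \<longleftrightarrow>
     (\<exists>S a. finite S \<and> \<tau> = (\<lambda>x. \<Sum>\<mu>\<in>S. a \<mu> * cis (\<mu> * x)))"

definition locally_lebesgue_integrable :: "(real \<Rightarrow> complex) \<Rightarrow> bool" where
  "locally_lebesgue_integrable f \<longleftrightarrow> (\<forall>a b. set_integrable lebesgue {a..b} f)"

definition besicovitch_dist :: "(real \<Rightarrow> complex) \<Rightarrow> (real \<Rightarrow> complex) \<Rightarrow> ereal" where
  "besicovitch_dist f g =
     Limsup at_top (\<lambda>T::real. ereal (1 / (2 * T) * (LINT x:{-T..T}|lebesgue. cmod (f x - g x))))"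

definition B_ap :: "(real \<Rightarrow> complex) \<Rightarrow> bool" where
  "B_ap f \<longleftrightarrow> locally_lebesgue_integrable f \<and>
     (\<exists>\<tau>::nat \<Rightarrow> real \<Rightarrow> complex. (\<forall>N. trig_sum (\<tau> N)) \<and>
        (\<lambda>N. besicovitch_dist f (\<tau> N)) \<longlonglongrightarrow> 0)"

text \<open>The limit below exists for every \<^const>\<open>B_ap\<close> function; otherwise the value is unspecified.\<close>

definition mean_value :: "(real \<Rightarrow> complex) \<Rightarrow> complex" where
  "mean_value f = Lim at_top (\<lambda>T::real. (LINT x:{0..T}|lebesgue. f x) / of_real T)"

definition fourier_coeff :: "(real \<Rightarrow> complex) \<Rightarrow> real \<Rightarrow> complex" where
  "fourier_coeff f \<mu> = mean_value (\<lambda>x. f x * cis (- (\<mu> * x)))"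

definition fourier_exponents :: "(real \<Rightarrow> complex) \<Rightarrow> real set" where
  "fourier_exponents f = {\<mu>. fourier_coeff f \<mu> \<noteq> 0}"

definition exponent_seq :: "(int \<Rightarrow> real) \<Rightarrow> bool" where
  "exponent_seq lam \<longleftrightarrow> lam 0 = 0 \<and> (\<forall>k. lam (- k) = - lam k) \<and>
     (\<forall>k\<ge>1. 0 < lam k \<and> lam k < lam (k + 1)) \<and> filterlim lam at_top at_top"

definition ap_class :: "(int \<Rightarrow> real) \<Rightarrow> (real \<Rightarrow> complex) set" where
  "ap_class lam = {f. B_ap f \<and> fourier_exponents f \<subseteq> range lam}"

definition A_coeff :: "(int \<Rightarrow> real) \<Rightarrow> int \<Rightarrow> (real \<Rightarrow> complex) \<Rightarrow> complex" where
  "A_coeff lam k f = fourier_coeff f (lam k)"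

definition has_series_F :: "(int \<Rightarrow> real) \<Rightarrow> (real \<Rightarrow> complex) \<Rightarrow> bool" where
  "has_series_F lam f \<longleftrightarrow> f \<in> ap_class lam \<and>
     (\<forall>k\<ge>1. cmod (A_coeff lam k f) + cmod (A_coeff lam (- k) f) > 0)"

text \<open>Orlicz functions are total on \<^typ>\<open>real\<close>; only their values on the half-line
  \<open>{0..}\<close> are constrained or used.\<close>

definition orlicz_function :: "(real \<Rightarrow> real) \<Rightarrow> bool" where
  "orlicz_function M \<longleftrightarrow> (\<forall>t\<ge>0. 0 \<le> M t) \<and> mono_on {0..} M \<and> convex_on {0..} M \<and>
     M 0 = 0 \<and> filterlim M at_top at_top"

text \<open>The conjugate may take the value \<open>\<infinity>\<close>; it is always nonnegative when \<open>M 0 = 0\<close>.\<close>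

definition conjugate :: "(real \<Rightarrow> real) \<Rightarrow> real \<Rightarrow> ereal" where
  "conjugate M v = (SUP u\<in>{0..}. ereal (u * v - M u))"

definition Gam :: "(int \<Rightarrow> real \<Rightarrow> real) \<Rightarrow> (int \<Rightarrow> real) set" where
  "Gam M = {\<gamma>. (\<forall>k. 0 < \<gamma> k) \<and> (\<Sum>\<^sub>\<infinity>k\<in>UNIV. conjugate (M k) (\<gamma> k)) \<le> 1}"

text \<open>Norm, best approximation and modulus of smoothness are suprema and infima that are
  finite only for suitable functions, so they take values in \<^typ>\<open>ennreal\<close>.\<close>

definition BS_norm ::
    "(int \<Rightarrow> real) \<Rightarrow> (int \<Rightarrow> real \<Rightarrow> real) \<Rightarrow> (real \<Rightarrow> complex) \<Rightarrow> ennreal" where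
  "BS_norm lam M f =
     (SUP \<gamma>\<in>Gam M. \<Sum>\<^sub>\<infinity>k\<in>UNIV. ennreal (\<gamma> k * cmod (A_coeff lam k f)))"

text \<open>Functions with the same Fourier series are not identified by passing to a quotient:
  every quantity here depends on a function only through its Fourier coefficients.\<close>

definition BS_space :: "(int \<Rightarrow> real) \<Rightarrow> (int \<Rightarrow> real \<Rightarrow> real) \<Rightarrow> (real \<Rightarrow> complex) set" where
  "BS_space lam M = {f \<in> ap_class lam. BS_norm lam M f < \<infinity>}"

definition best_approx ::
    "(int \<Rightarrow> real) \<Rightarrow> (int \<Rightarrow> real \<Rightarrow> real) \<Rightarrow> nat \<Rightarrow> (real \<Rightarrow> complex) \<Rightarrow> ennreal" where
  "best_approx lam M n f =
     (INF g\<in>{g \<in> ap_class lam. fourier_exponents g \<subseteq> {- lam (int n)<..<lam (int n)}}.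
        BS_norm lam M (\<lambda>x. f x - g x))"

definition phi :: "real \<Rightarrow> real \<Rightarrow> real" where
  "phi \<alpha> t = 2 powr (\<alpha> / 2) * (1 - cos t) powr (\<alpha> / 2)"

definition modulus ::
    "(int \<Rightarrow> real) \<Rightarrow> (int \<Rightarrow> real \<Rightarrow> real) \<Rightarrow> real \<Rightarrow> (real \<Rightarrow> complex) \<Rightarrow> real \<Rightarrow> ennreal" where
  "modulus lam M \<alpha> f \<delta> =
     (SUP h\<in>{h. \<bar>h\<bar> \<le> \<delta>}. SUP \<gamma>\<in>Gam M.
        \<Sum>\<^sub>\<infinity>k\<in>UNIV. ennreal (\<gamma> k * phi \<alpha> (lam k * h) * cmod (A_coeff lam k f)))"

end

theory Submission
  imports Defs
begin

text \<open>
  Put \<open>C = (\<pi>/\<lambda>\<^sub>n)\<^sup>\<alpha>\<close> and \<open>d\<^sub>\<nu> = \<lambda>\<^sub>\<nu>\<^sup>\<alpha> - \<lambda>\<^bsub>\<nu>-1\<^esub>\<^sup>\<alpha>\<close>.  The modulus of smoothness weights the \<open>k\<close>-th Fourier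
  coefficient by the multiplier \<open>\<phi>\<^sub>\<alpha>(\<lambda>\<^sub>k h)\<close>, where \<open>\<bar>h\<bar> \<le> \<pi>/\<lambda>\<^sub>n\<close>.  Two elementary bounds control it:
  \<open>\<phi>\<^sub>\<alpha>(t) \<le> \<bar>t\<bar>\<^sup>\<alpha>\<close> for the low frequencies \<open>\<bar>k\<bar> \<le> n\<close>, and \<open>\<phi>\<^sub>\<alpha> \<le> 2\<^sup>\<alpha> \<le> \<pi>\<^sup>\<alpha>\<close> for the high ones.  Together
  they bound the multiplier by \<open>C\<close> times the \<open>\<alpha>\<close>-th power of the exponent with index
  \<open>min(\<bar>k\<bar>, n)\<close>.  As \<open>\<lambda>\<^sub>0 = 0\<close>, that power telescopes into the sum of the \<open>d\<^sub>\<nu>\<close> over those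
  \<open>\<nu> \<le> n\<close> with \<open>\<nu> \<le> \<bar>k\<bar>\<close> (\<open>phi_multiplier_le\<close>).  Interchanging the sums over \<open>k\<close> and \<open>\<nu>\<close> leaves, in
  front of each \<open>d\<^sub>\<nu>\<close>, the tail of the weighted Fourier coefficients over \<open>\<bar>k\<bar> \<ge> \<nu>\<close>.

  Such a tail is at most the best approximation \<open>E\<close> of index \<open>\<nu>\<close> (\<open>tail_le_best_approx\<close>): subtracting
  a function \<open>g\<close> whose exponents lie in \<open>(-\<lambda>\<^sub>\<nu>, \<lambda>\<^sub>\<nu>)\<close> changes no coefficient with \<open>\<bar>k\<bar> \<ge> \<nu>\<close>, so the
  tail of \<open>f\<close> is part of the sum that the norm of \<open>f - g\<close> dominates.

  The analytic ingredient is that Fourier coefficients are additive (\<open>fourier_coeff_diff\<close>).  This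
  rests on the existence of mean values of almost periodic functions (\<open>B_ap_mean_converges\<close>):
  the means of a trigonometric sum converge, and the means of \<open>f\<close> stay, for large \<open>T\<close>, uniformly
  close to those of a sum that approximates \<open>f\<close>, so they satisfy the Cauchy criterion.
\<close>

section \<open>Mean values of Besicovitch almost periodic functions\<close>

lemma set_integrable_mult_continuous:
  fixes f c :: "real \<Rightarrow> complex"
  assumes f: "set_integrable lebesgue {a..b} f" and c: "continuous_on {a..b} c"
  shows "set_integrable lebesgue {a..b} (\<lambda>x. f x * c x)"
proof -
  have "bilinear (\<lambda>u v::complex. v * u)"
    by (auto simp: bilinear_def linear_iff algebra_simps)
  moreover have "c \<in> borel_measurable (lebesgue_on {a..b})"
    by (rule continuous_imp_measurable_on_sets_lebesgue[OF c]) auto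
  moreover have "bounded (c ` {a..b})"
    using c by (intro compact_imp_bounded compact_continuous_image) auto
  ultimately show ?thesis
    using absolutely_integrable_bounded_measurable_product[of "\<lambda>u v. v * u" c "{a..b}" f] f by simp
qed

lemma continuous_on_character [continuous_intros]:
  "continuous_on S (\<lambda>x::real. cis (\<mu> * x))"
  by (intro continuous_intros)

lemma set_integrable_trig_sum:
  assumes "trig_sum \<tau>"
  shows "set_integrable lebesgue {a..b} \<tau>"
proof -
  from assms obtain S c where "\<tau> = (\<lambda>x. \<Sum>\<mu>\<in>S. c \<mu> * cis (\<mu> * x))"
    unfolding trig_sum_def by blast
  then show ?thesis
    by (auto intro!: absolutely_integrable_continuous_real continuous_intros)
qed

lemma character_has_vector_derivative:
  assumes "\<mu> \<noteq> 0"
  shows "((\<lambda>x. cis (\<mu> * x) / (\<i> * of_real \<mu>)) has_vector_derivative cis (\<mu> * x)) (at x within S)"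
proof -
  have "((\<lambda>x. cis (\<mu> * x)) has_vector_derivative (\<i> * of_real \<mu> * cis (\<mu> * x))) (at x within S)"
    unfolding has_vector_derivative_def
    by (rule derivative_eq_intros refl)+ (auto simp: scaleR_conv_of_real algebra_simps)
  from has_vector_derivative_mult_right[OF this, of "inverse (\<i> * of_real \<mu>)"]
  show ?thesis
    using assms by (simp add: field_simps)
qed

text \<open>A nonconstant character has a bounded primitive, so its means over \<open>[0, T]\<close> are \<open>O(1/T)\<close>.\<close>

lemma character_mean_tendsto:
  "((\<lambda>T. (LINT x:{0..T}|lebesgue. cis (\<mu> * x)) / of_real T) \<longlongrightarrow> (if \<mu> = 0 then 1 else 0)) at_top"
proof (cases "\<mu> = 0")
  case True
  have "eventually (\<lambda>T. (LINT x:{0..T}|lebesgue. cis (\<mu> * x)) / of_real T = 1) at_top"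
    using eventually_gt_at_top[of 0]
  proof eventually_elim
    case (elim T)
    have "(LINT x:{0..T}|lebesgue. cis (\<mu> * x)) = integral {0..T} (\<lambda>x. 1 :: complex)"
      using True by (subst set_lebesgue_integral_eq_integral) 
        (auto intro!: absolutely_integrable_continuous_real continuous_intros)
    then show ?case
      using elim by (simp add: scaleR_conv_of_real)
  qed
  then show ?thesis
    using True by (auto intro: tendsto_eventually)
next
  case False
  have "eventually (\<lambda>T. norm ((LINT x:{0..T}|lebesgue. cis (\<mu> * x)) / of_real T) \<le> 2 / \<bar>\<mu>\<bar> / T) at_top"
    using eventually_gt_at_top[of 0]
  proof eventually_elim
    case (elim T)
    have "((\<lambda>x. cis (\<mu> * x)) has_integral
        cis (\<mu> * T) / (\<i> * of_real \<mu>) - cis (\<mu> * 0) / (\<i> * of_real \<mu>)) {0..T}"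
      using elim False
      by (intro fundamental_theorem_of_calculus character_has_vector_derivative) auto
    then have "(LINT x:{0..T}|lebesgue. cis (\<mu> * x)) = (cis (\<mu> * T) - 1) / (\<i> * of_real \<mu>)"
      by (subst set_lebesgue_integral_eq_integral)
        (auto intro!: absolutely_integrable_continuous_real continuous_intros
              simp: integral_unique diff_divide_distrib)
    moreover have "norm (cis (\<mu> * T) - 1) \<le> 2"
      using norm_triangle_ineq4[of "cis (\<mu> * T)" 1] by simp
    ultimately show ?case
      using elim by (simp add: norm_divide norm_mult divide_right_mono)
  qed
  moreover have "((\<lambda>T. 2 / \<bar>\<mu>\<bar> / T) \<longlongrightarrow> 0) at_top"
    by (intro tendsto_divide_0[OF tendsto_const] filterlim_at_top_imp_at_infinity filterlim_ident)
  ultimately show ?thesis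
    using False by (auto intro: Lim_null_comparison)
qed

lemma trig_sum_mean_converges:
  assumes "trig_sum \<tau>"
  shows "\<exists>L. ((\<lambda>T. (LINT x:{0..T}|lebesgue. \<tau> x * cis (- (\<mu> * x))) / of_real T) \<longlongrightarrow> L) at_top"
proof -
  from assms obtain S c where S: "finite S" and \<tau>: "\<tau> = (\<lambda>x. \<Sum>\<kappa>\<in>S. c \<kappa> * cis (\<kappa> * x))"
    unfolding trig_sum_def by blast
  have "(LINT x:{0..T}|lebesgue. \<tau> x * cis (- (\<mu> * x))) / of_real T =
      (\<Sum>\<kappa>\<in>S. c \<kappa> * ((LINT x:{0..T}|lebesgue. cis ((\<kappa> - \<mu>) * x)) / of_real T))" for T
  proof -
    have "(\<lambda>x. \<tau> x * cis (- (\<mu> * x))) = (\<lambda>x. \<Sum>\<kappa>\<in>S. c \<kappa> * cis ((\<kappa> - \<mu>) * x))"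
      unfolding \<tau> sum_distrib_right mult.assoc cis_mult by (simp add: left_diff_distrib)
    moreover have "(LINT x:{0..T}|lebesgue. (\<Sum>\<kappa>\<in>S. c \<kappa> * cis ((\<kappa> - \<mu>) * x))) =
        (\<Sum>\<kappa>\<in>S. c \<kappa> * (LINT x:{0..T}|lebesgue. cis ((\<kappa> - \<mu>) * x)))"
      unfolding set_integral_mult_right[symmetric]
      unfolding set_lebesgue_integral_def scaleR_sum_right
      by (intro Bochner_Integration.integral_sum)
        (intro absolutely_integrable_continuous_real[unfolded set_integrable_def] continuous_intros)
    ultimately show ?thesis
      by (simp add: sum_divide_distrib)
  qed
  moreover have "((\<lambda>T. \<Sum>\<kappa>\<in>S. c \<kappa> * ((LINT x:{0..T}|lebesgue. cis ((\<kappa> - \<mu>) * x)) / of_real T)) \<longlongrightarrow>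
      (\<Sum>\<kappa>\<in>S. c \<kappa> * (if \<kappa> - \<mu> = 0 then 1 else 0))) at_top"
    by (intro tendsto_sum tendsto_mult tendsto_const character_mean_tendsto)
  ultimately show ?thesis
    by (intro exI) (simp only:)
qed

text \<open>Means are taken over \<open>[0, T]\<close>, whereas the Besicovitch distance averages over \<open>[-T, T]\<close>;
  enlarging the interval costs the factor 2.\<close>

lemma mean_dist_le_besicovitch:
  assumes f: "locally_lebesgue_integrable f" and \<tau>: "\<And>a b. set_integrable lebesgue {a..b} \<tau>"
    and T: "T > 0"
  shows "cmod ((LINT x:{0..T}|lebesgue. f x * cis (- (\<mu> * x))) / of_real T -
               (LINT x:{0..T}|lebesgue. \<tau> x * cis (- (\<mu> * x))) / of_real T)
         \<le> 2 * (1 / (2 * T) * (LINT x:{-T..T}|lebesgue. cmod (f x - \<tau> x)))"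
proof -
  let ?c = "\<lambda>x. cis (- (\<mu> * x))"
  have int_f: "set_integrable lebesgue {a..b} f" for a b
    using f unfolding locally_lebesgue_integrable_def by blast
  have int_c: "set_integrable lebesgue {a..b} (\<lambda>x. h x * ?c x)"
    if "set_integrable lebesgue {a..b} h" for a b h
    using that by (intro set_integrable_mult_continuous continuous_intros)
  have int_d: "set_integrable lebesgue {a..b} (\<lambda>x. cmod (f x - \<tau> x))" for a b
    using int_f \<tau> by (intro set_integrable_norm set_integral_diff)
  have "(LINT x:{0..T}|lebesgue. f x * ?c x) - (LINT x:{0..T}|lebesgue. \<tau> x * ?c x) =
      (LINT x:{0..T}|lebesgue. (f x - \<tau> x) * ?c x)"
    unfolding left_diff_distrib by (rule set_integral_diff(2)[symmetric]) (intro int_c int_f \<tau>)+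
  also have "cmod \<dots> \<le> (LINT x:{0..T}|lebesgue. cmod ((f x - \<tau> x) * ?c x))"
    by (intro set_integral_norm_bound int_c set_integral_diff int_f \<tau>)
  also have "\<dots> = (LINT x:{0..T}|lebesgue. cmod (f x - \<tau> x))"
    by (simp add: norm_mult)
  also have "\<dots> \<le> (LINT x:{-T..T}|lebesgue. cmod (f x - \<tau> x))"
    unfolding set_lebesgue_integral_def using T
    by (intro integral_mono int_d[unfolded set_integrable_def]) (auto simp: indicator_def)
  finally show ?thesis
    using T by (simp add: diff_divide_distrib[symmetric] norm_divide divide_right_mono)
qed

text \<open>For a trigonometric sum close to \<open>f\<close>, the means of \<open>f\<close> eventually lie in a small ball about
  the limit of the means of that sum; the balls shrink as the sum improves, which is the Cauchy
  criterion.\<close>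

lemma B_ap_mean_converges:
  assumes "B_ap f"
  shows "\<exists>L. ((\<lambda>T. (LINT x:{0..T}|lebesgue. f x * cis (- (\<mu> * x))) / of_real T) \<longlongrightarrow> L) at_top"
proof -
  define F where "F h T = (LINT x:{0..T}|lebesgue. h x * cis (- (\<mu> * x))) / of_real T"
    for h :: "real \<Rightarrow> complex" and T :: real
  from assms obtain \<tau> where f: "locally_lebesgue_integrable f"
    and \<tau>: "\<And>N. trig_sum (\<tau> N)" and lim: "(\<lambda>N. besicovitch_dist f (\<tau> N)) \<longlonglongrightarrow> 0"
    unfolding B_ap_def by blast
  have "cauchy_filter (filtermap (F f) at_top)"
    unfolding cauchy_filter_metric_filtermap
  proof (intro allI impI)
    fix e :: real assume e: "e > 0"
    \<comment> \<open>Distance \<open>e/8\<close> becomes \<open>e/4\<close> on \<open>[0, T]\<close>; another \<open>e/4\<close> is spent on the limit of the sum's means.\<close>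
    have "eventually (\<lambda>N. besicovitch_dist f (\<tau> N) < ereal (e / 8)) sequentially"
      using lim e by (intro order_tendstoD) auto
    then obtain N where "besicovitch_dist f (\<tau> N) < ereal (e / 8)"
      using eventually_happens by force
    then have close: "eventually (\<lambda>T. 1 / (2 * T) *
        (LINT x:{-T..T}|lebesgue. cmod (f x - \<tau> N x)) < e / 8) at_top"
      unfolding besicovitch_dist_def by (auto dest: Limsup_lessD)
    obtain L where "(F (\<tau> N) \<longlongrightarrow> L) at_top"
      using trig_sum_mean_converges[OF \<tau>, of N \<mu>] unfolding F_def by blast
    then have "eventually (\<lambda>T. dist (F (\<tau> N) T) L < e / 4) at_top"
      using e by (intro tendstoD) auto
    with close eventually_gt_at_top[of 0] have "eventually (\<lambda>T. dist (F f T) L < e / 2) at_top"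
    proof eventually_elim
      case (elim T)
      have "dist (F f T) (F (\<tau> N) T) < e / 4"
        using mean_dist_le_besicovitch[OF f set_integrable_trig_sum[OF \<tau>[of N]] elim(2), of \<mu>] elim(1)
        unfolding F_def dist_norm by linarith
      with elim(3) show ?case
        using dist_triangle[of "F f T" L "F (\<tau> N) T"] by linarith
    qed
    then show "\<exists>P. eventually P at_top \<and> (\<forall>x y. P x \<and> P y \<longrightarrow> dist (F f x) (F f y) < e)"
      by (intro exI[of _ "\<lambda>T. dist (F f T) L < e / 2"]) (auto intro: dist_triangle_half_l)
  qed
  moreover have "complete (UNIV :: complex set)"
    by (rule complete_UNIV)
  ultimately obtain L where "(F f \<longlongrightarrow> L) at_top"
    using complete_uniform[where S="UNIV :: complex set"] by (force simp: filterlim_def)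
  then show ?thesis
    unfolding F_def by blast
qed

text \<open>Mean values are defined through \<^const>\<open>Lim\<close>, which takes an unspecified value where the limit does
  not exist; additivity therefore depends on the convergence of both means.\<close>

lemma fourier_coeff_diff:
  assumes f: "B_ap f" and g: "B_ap g"
  shows "fourier_coeff (\<lambda>x. f x - g x) \<mu> = fourier_coeff f \<mu> - fourier_coeff g \<mu>"
proof -
  define F where "F h T = (LINT x:{0..T}|lebesgue. h x * cis (- (\<mu> * x))) / of_real T"
    for h :: "real \<Rightarrow> complex" and T :: real
  have coeff: "fourier_coeff h \<mu> = L" if "(F h \<longlongrightarrow> L) at_top" for h L
    using that unfolding fourier_coeff_def mean_value_def F_def
    by (intro tendsto_Lim) auto
  obtain L K where L: "(F f \<longlongrightarrow> L) at_top" and K: "(F g \<longlongrightarrow> K) at_top"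
    using B_ap_mean_converges[OF f, of \<mu>] B_ap_mean_converges[OF g, of \<mu>] unfolding F_def by blast
  have "F (\<lambda>x. f x - g x) = (\<lambda>T. F f T - F g T)"
  proof
    fix T
    have "set_integrable lebesgue {0..T} (\<lambda>x. h x * cis (- (\<mu> * x)))" if "B_ap h" for h
      using that unfolding B_ap_def locally_lebesgue_integrable_def
      by (intro set_integrable_mult_continuous continuous_intros) blast
    then show "F (\<lambda>x. f x - g x) T = F f T - F g T"
      using f g unfolding F_def by (simp add: left_diff_distrib diff_divide_distrib)
  qed
  with L K have "(F (\<lambda>x. f x - g x) \<longlongrightarrow> L - K) at_top"
    by (auto intro: tendsto_diff)
  then show ?thesis
    using coeff L K by metis
qed

section \<open>Tails of the Fourier series and best approximation\<close>

lemma exponent_seq_abs: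
  assumes "exponent_seq lam"
  shows "\<bar>lam k\<bar> = lam \<bar>k\<bar>"
proof (cases "k = 0")
  case False
  then have "lam \<bar>k\<bar> > 0"
    using assms unfolding exponent_seq_def by (auto simp: abs_if)
  moreover have "lam (- k) = - lam k"
    using assms unfolding exponent_seq_def by blast
  ultimately show ?thesis
    by (auto simp: abs_if split: if_splits)
qed (use assms in \<open>auto simp: exponent_seq_def\<close>)

lemma exponent_seq_mono:
  assumes "exponent_seq lam" "0 \<le> j" "j \<le> k"
  shows "lam j \<le> lam k"
  using assms(3)
proof (induction k rule: int_ge_induct)
  case (step i)
  have "lam i \<le> lam (i + 1)"
  proof (cases "i = 0")
    case True
    have "0 < lam 1"
      using assms(1) unfolding exponent_seq_def by auto
    then show ?thesis
      using True assms(1) unfolding exponent_seq_def by auto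
  next
    case False
    then have "i \<ge> 1"
      using step assms(2) by linarith
    then show ?thesis
      using assms(1) unfolding exponent_seq_def by (auto intro: less_imp_le)
  qed
  with step show ?case
    by linarith
qed simp

lemma sum_le_infsum_ennreal:
  fixes u :: "'a \<Rightarrow> ennreal"
  assumes "finite F" "F \<subseteq> A"
  shows "sum u F \<le> infsum u A"
  using assms by (subst nonneg_infsum_complete) (auto intro: SUP_upper)

text \<open>An admissible \<open>g\<close> has no exponent \<open>\<lambda>\<^sub>k\<close> with \<open>\<bar>k\<bar> \<ge> \<nu>\<close>, so \<open>f\<close> and \<open>f - g\<close> have the same coefficients
  there.  The tail is taken over a finite set \<open>F\<close> because an infinite sum in \<^typ>\<open>ennreal\<close> is the
  supremum of its finite partial sums, and finite sums can be interchanged and scaled freely.\<close>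

lemma tail_le_best_approx:
  assumes lam: "exponent_seq lam" and f: "f \<in> ap_class lam" and \<gamma>: "\<gamma> \<in> Gam M"
    and F: "finite F"
  shows "(\<Sum>k\<in>{k\<in>F. int \<nu> \<le> \<bar>k\<bar>}. ennreal (\<gamma> k * cmod (A_coeff lam k f))) \<le> best_approx lam M \<nu> f"
  unfolding best_approx_def
proof (rule INF_greatest, safe)
  fix g assume g: "g \<in> ap_class lam" "fourier_exponents g \<subseteq> {- lam (int \<nu>)<..<lam (int \<nu>)}"
  have "A_coeff lam k (\<lambda>x. f x - g x) = A_coeff lam k f" if k: "int \<nu> \<le> \<bar>k\<bar>" for k
  proof -
    have "lam (int \<nu>) \<le> \<bar>lam k\<bar>"
      using k exponent_seq_abs[OF lam] exponent_seq_mono[OF lam] by simp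
    then have "lam k \<notin> fourier_exponents g"
      using subsetD[OF g(2), of "lam k"] by auto
    then show ?thesis
      using f g(1) by (auto simp: A_coeff_def fourier_exponents_def ap_class_def fourier_coeff_diff)
  qed
  then have "(\<Sum>k\<in>{k\<in>F. int \<nu> \<le> \<bar>k\<bar>}. ennreal (\<gamma> k * cmod (A_coeff lam k f))) =
      (\<Sum>k\<in>{k\<in>F. int \<nu> \<le> \<bar>k\<bar>}. ennreal (\<gamma> k * cmod (A_coeff lam k (\<lambda>x. f x - g x))))"
    by (intro sum.cong) auto
  also have "\<dots> \<le> (\<Sum>\<^sub>\<infinity>k. ennreal (\<gamma> k * cmod (A_coeff lam k (\<lambda>x. f x - g x))))"
    using F by (intro sum_le_infsum_ennreal) auto
  also have "\<dots> \<le> BS_norm lam M (\<lambda>x. f x - g x)"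
    unfolding BS_norm_def using \<gamma> by (rule SUP_upper)
  finally show "(\<Sum>k\<in>{k\<in>F. int \<nu> \<le> \<bar>k\<bar>}. ennreal (\<gamma> k * cmod (A_coeff lam k f)))
      \<le> BS_norm lam M (\<lambda>x. f x - g x)" .
qed

section \<open>The multiplier of the modulus of smoothness\<close>

text \<open>By the half-angle formula \<open>\<phi>\<^sub>\<alpha>(t) = (2 \<bar>sin (t/2)\<bar>)\<^sup>\<alpha>\<close>, and both bounds are bounds for the sine.\<close>

lemma phi_bounds:
  assumes "\<alpha> > 0"
  shows phi_le_powr: "phi \<alpha> t \<le> \<bar>t\<bar> powr \<alpha>" and phi_le_two_powr: "phi \<alpha> t \<le> 2 powr \<alpha>"
proof -
  have eq: "2 * (1 - cos t) = (2 * \<bar>sin (t / 2)\<bar>)\<^sup>2"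
    using cos_double_sin[of "t / 2"] by (simp add: power_mult_distrib)
  have "phi \<alpha> t = (2 * (1 - cos t)) powr (\<alpha> / 2)"
    unfolding phi_def by (rule powr_mult[symmetric])
  also have "\<dots> = (2 * \<bar>sin (t / 2)\<bar>) powr \<alpha>"
  proof (cases "sin (t / 2) = 0")
    case False
    define s where "s = 2 * \<bar>sin (t / 2)\<bar>"
    have "s > 0"
      using False by (simp add: s_def)
    then have "s\<^sup>2 powr (\<alpha> / 2) = s powr \<alpha>"
      by (simp add: powr_powr flip: powr_numeral)
    then show ?thesis
      unfolding eq s_def .
  next
    case True
    show ?thesis
      unfolding eq using True by simp
  qed
  finally have phi: "phi \<alpha> t = (2 * \<bar>sin (t / 2)\<bar>) powr \<alpha>" .
  show "phi \<alpha> t \<le> \<bar>t\<bar> powr \<alpha>" "phi \<alpha> t \<le> 2 powr \<alpha>"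
    unfolding phi using abs_sin_x_le_abs_x[of "t / 2"] assms by (auto intro!: powr_mono2)
qed

lemma truncated_telescoping_sum:
  fixes b :: "nat \<Rightarrow> 'a::ab_group_add"
  shows "(\<Sum>\<nu>\<in>{\<nu>\<in>{1..n}. \<nu> \<le> m}. b \<nu> - b (\<nu> - 1)) = b (min m n) - b 0"
proof -
  have "{\<nu>\<in>{1..n}. \<nu> \<le> m} = {Suc 0..min m n}"
    by auto
  moreover have "(\<Sum>\<nu>=Suc 0..N. b \<nu> - b (\<nu> - 1)) = b N - b 0" for N
    by (induction N) simp_all
  ultimately show ?thesis
    by simp
qed

text \<open>The sum on the right is the telescoped form of \<open>\<lambda>\<^sub>j\<^sup>\<alpha>\<close> with \<open>j = min(\<bar>k\<bar>, n)\<close>.  In this form the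
  dependence on \<open>k\<close> sits entirely in the condition \<open>\<nu> \<le> \<bar>k\<bar>\<close>, which produces the tails after the
  summations are interchanged.\<close>

lemma phi_multiplier_le:
  assumes lam: "exponent_seq lam" and "n \<ge> 1" "\<alpha> > 0" and h: "\<bar>h\<bar> \<le> pi / lam (int n)"
  shows "phi \<alpha> (lam k * h) \<le> (pi / lam (int n)) powr \<alpha> *
    (\<Sum>\<nu>\<in>{\<nu>\<in>{1..n}. int \<nu> \<le> \<bar>k\<bar>}. lam (int \<nu>) powr \<alpha> - lam (int \<nu> - 1) powr \<alpha>)"
proof -
  define m where "m = nat \<bar>k\<bar>"
  have pos: "lam (int n) > 0"
    using lam \<open>n \<ge> 1\<close> unfolding exponent_seq_def by auto
  have nonneg: "lam (int j) \<ge> 0" for j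
    using exponent_seq_mono[OF lam, of 0 "int j"] lam by (simp add: exponent_seq_def)
  have "(\<Sum>\<nu>\<in>{\<nu>\<in>{1..n}. int \<nu> \<le> \<bar>k\<bar>}. lam (int \<nu>) powr \<alpha> - lam (int \<nu> - 1) powr \<alpha>) =
      (\<Sum>\<nu>\<in>{\<nu>\<in>{1..n}. \<nu> \<le> m}. lam (int \<nu>) powr \<alpha> - lam (int (\<nu> - 1)) powr \<alpha>)"
    by (intro sum.cong) (auto simp: m_def of_nat_diff)
  also have "\<dots> = lam (int (min m n)) powr \<alpha>"
    using truncated_telescoping_sum[of "\<lambda>j. lam (int j) powr \<alpha>" n m] lam
    by (simp add: exponent_seq_def)
  finally have sum: "(\<Sum>\<nu>\<in>{\<nu>\<in>{1..n}. int \<nu> \<le> \<bar>k\<bar>}. lam (int \<nu>) powr \<alpha> - lam (int \<nu> - 1) powr \<alpha>) =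
      lam (int (min m n)) powr \<alpha>" .
  have "phi \<alpha> (lam k * h) \<le> (pi / lam (int n) * lam (int (min m n))) powr \<alpha>"
  proof (cases "m \<le> n")
    case True
    have "\<bar>lam k * h\<bar> = \<bar>h\<bar> * lam (int m)"
      using exponent_seq_abs[OF lam, of k] by (simp add: abs_mult m_def)
    also have "\<dots> \<le> pi / lam (int n) * lam (int m)"
      using h nonneg by (intro mult_right_mono)
    finally have "\<bar>lam k * h\<bar> powr \<alpha> \<le> (pi / lam (int n) * lam (int m)) powr \<alpha>"
      using \<open>\<alpha> > 0\<close> by (intro powr_mono2) auto
    with True phi_le_powr[OF \<open>\<alpha> > 0\<close>, of "lam k * h"] show ?thesis
      by simp
  next
    case False
    \<comment> \<open>Here the minimum is \<open>n\<close>, and the claim reduces to \<open>\<phi>\<^sub>\<alpha> \<le> \<pi>\<^sup>\<alpha>\<close>.\<close>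
    have "2 powr \<alpha> \<le> pi powr \<alpha>"
      using \<open>\<alpha> > 0\<close> pi_ge_two by (intro powr_mono2) auto
    with False phi_le_two_powr[OF \<open>\<alpha> > 0\<close>, of "lam k * h"] pos show ?thesis
      by (simp add: min_def)
  qed
  then show ?thesis
    unfolding sum powr_mult .
qed

theorem theorem4p2:
  fixes lam :: "int \<Rightarrow> real" and M :: "int \<Rightarrow> real \<Rightarrow> real"
    and f :: "real \<Rightarrow> complex" and n :: nat and \<alpha> :: real
  assumes "exponent_seq lam"
    and "\<And>k. orlicz_function (M k)"
    and "f \<in> BS_space lam M"
    and "has_series_F lam f"
    and "n \<ge> 1"
    and "\<alpha> > 0"
  shows "modulus lam M \<alpha> f (pi / lam (int n)) \<le>
    ennreal ((pi / lam (int n)) powr \<alpha>) *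
    (\<Sum>\<nu>=1..n. ennreal (lam (int \<nu>) powr \<alpha> - lam (int \<nu> - 1) powr \<alpha>) * best_approx lam M \<nu> f)"
proof -
  define C where "C = (pi / lam (int n)) powr \<alpha>"
  define d where "d \<nu> = lam (int \<nu>) powr \<alpha> - lam (int \<nu> - 1) powr \<alpha>" for \<nu> :: nat
  have f: "f \<in> ap_class lam"
    using assms(3) by (simp add: BS_space_def)
  have d_nonneg: "d \<nu> \<ge> 0" if "\<nu> \<ge> 1" for \<nu>
  proof -
    have "0 \<le> lam (int \<nu> - 1)" "lam (int \<nu> - 1) \<le> lam (int \<nu>)"
      using exponent_seq_mono[OF assms(1), of 0 "int \<nu> - 1"] assms(1) that
        exponent_seq_mono[OF assms(1), of "int \<nu> - 1" "int \<nu>"] by (auto simp: exponent_seq_def)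
    then show ?thesis
      unfolding d_def using \<open>\<alpha> > 0\<close> by (simp add: powr_mono2)
  qed
  have "(\<Sum>k\<in>F. ennreal (\<gamma> k * phi \<alpha> (lam k * h) * cmod (A_coeff lam k f))) \<le>
      ennreal C * (\<Sum>\<nu>=1..n. ennreal (d \<nu>) * best_approx lam M \<nu> f)"
    if h: "\<bar>h\<bar> \<le> pi / lam (int n)" and \<gamma>: "\<gamma> \<in> Gam M" and F: "finite F" for h \<gamma> F
  proof -
    define w where "w k = \<gamma> k * cmod (A_coeff lam k f)" for k
    have w: "w k \<ge> 0" for k
      using \<gamma> unfolding w_def Gam_def by (simp add: less_imp_le)
    have term_le: "ennreal (\<gamma> k * phi \<alpha> (lam k * h) * cmod (A_coeff lam k f)) \<le>
        ennreal C * (\<Sum>\<nu>\<in>{\<nu>\<in>{1..n}. int \<nu> \<le> \<bar>k\<bar>}. ennreal (d \<nu>) * ennreal (w k))" for k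
    proof -
      have "\<gamma> k * phi \<alpha> (lam k * h) * cmod (A_coeff lam k f) = phi \<alpha> (lam k * h) * w k"
        by (simp add: w_def)
      also have "\<dots> \<le> C * (\<Sum>\<nu>\<in>{\<nu>\<in>{1..n}. int \<nu> \<le> \<bar>k\<bar>}. d \<nu>) * w k"
        unfolding C_def d_def
        using phi_multiplier_le[OF assms(1,5,6) h, of k] w by (intro mult_right_mono)
      also have "\<dots> = C * (\<Sum>\<nu>\<in>{\<nu>\<in>{1..n}. int \<nu> \<le> \<bar>k\<bar>}. d \<nu> * w k)"
        by (simp add: sum_distrib_right mult.assoc)
      finally have "ennreal (\<gamma> k * phi \<alpha> (lam k * h) * cmod (A_coeff lam k f)) \<le>
          ennreal (C * (\<Sum>\<nu>\<in>{\<nu>\<in>{1..n}. int \<nu> \<le> \<bar>k\<bar>}. d \<nu> * w k))"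
        by (rule ennreal_leI)
      also have "\<dots> = ennreal C * (\<Sum>\<nu>\<in>{\<nu>\<in>{1..n}. int \<nu> \<le> \<bar>k\<bar>}. ennreal (d \<nu> * w k))"
        using w d_nonneg by (subst sum_ennreal) (auto simp: C_def intro!: ennreal_mult sum_nonneg)
      also have "\<dots> = ennreal C * (\<Sum>\<nu>\<in>{\<nu>\<in>{1..n}. int \<nu> \<le> \<bar>k\<bar>}. ennreal (d \<nu>) * ennreal (w k))"
        using w d_nonneg by (auto intro!: sum.cong arg_cong2[where f="(*)"] simp: ennreal_mult)
      finally show ?thesis .
    qed
    have "(\<Sum>k\<in>F. ennreal (\<gamma> k * phi \<alpha> (lam k * h) * cmod (A_coeff lam k f))) \<le>
        ennreal C * (\<Sum>k\<in>F. \<Sum>\<nu>\<in>{\<nu>\<in>{1..n}. int \<nu> \<le> \<bar>k\<bar>}. ennreal (d \<nu>) * ennreal (w k))"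
      unfolding sum_distrib_left[of _ _ F] by (intro sum_mono term_le)
    also have "(\<Sum>k\<in>F. \<Sum>\<nu>\<in>{\<nu>\<in>{1..n}. int \<nu> \<le> \<bar>k\<bar>}. ennreal (d \<nu>) * ennreal (w k)) =
        (\<Sum>\<nu>=1..n. ennreal (d \<nu>) * (\<Sum>k\<in>{k\<in>F. int \<nu> \<le> \<bar>k\<bar>}. ennreal (w k)))"
      unfolding sum_distrib_left using F by (intro sum.swap_restrict) auto
    also have "\<dots> \<le> (\<Sum>\<nu>=1..n. ennreal (d \<nu>) * best_approx lam M \<nu> f)"
      unfolding w_def
      by (intro sum_mono mult_left_mono tail_le_best_approx[OF assms(1) f \<gamma> F]) auto
    finally show ?thesis
      by (simp add: mult_left_mono)
  qed
  then show ?thesis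
    unfolding modulus_def C_def d_def
    by (intro SUP_least) (auto simp: nonneg_infsum_complete intro!: SUP_least)
qed

end
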